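(* Let $\mathcal O$ be the orbit of the walk and $k(\mathcal O)\subset\mathbb K$ the field generated over $k=\mathbb C(S(x,y))$ by all coordinates of the pairs of $\mathcal O$. Then the field extensions $k(\mathcal O)\,|\,k(x)$, $k(\mathcal O)\,|\,k(y)$ and $k(\mathcal O)\,|\,k(x,y)$ are Galois.
   Context: Fix a finite set $\mathcal S\subset\mathbb Z^2$ and nonzero complex weights $(w_s)_{s\in\mathcal S}$; the step polynomial is the Laurent polynomial $S(X,Y)=\sum_{(i,j)\in\mathcal S}w_{(i,j)}X^iY^j$, assumed not univariate (it involves both $X$ and $Y$). Let $x,y$ be algebraically independent over $\mathbb C$, let $k=\mathbb C(S(x,y))$, and let $\mathbb K$ be a fixed algebraic closure of $\mathbb C(x,y)$. For $(u,v),(u',v')\in\mathbb K\times\mathbb K$ write $(u,v)\sim^x(u',v')$ if $u=u'$ and $S(u,v)=S(u',v')$, and $(u,v)\sim^y(u',v')$ if $v=v'$ and $S(u,v)=S(u',v')$. The orbit $\mathcal O$ is the equivalence class of $(x,y)$ for the equivalence relation on $\mathbb K\times\mathbb K$ generated by $\sim^x$ and $\sim^y$ (reflexive transitive closure of their union). An algebraic field extension $L\,|\,M$ (possibly of infinite degree) is called Galois if the set of elements of $L$ fixed by every field automorphism of $L$ fixing $M$ pointwise is exactly $M$. *)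

theory Defs
  imports Complex_Main "HOL-Computational_Algebra.Polynomial"
begin

text \<open>
  The ambient field is a type \<open>'k\<close>; its subfields are subsets of \<open>'k\<close>, and an extension
  \<open>L | M\<close> is given by two subfields \<open>M \<subseteq> L\<close>.
\<close>

definition is_subfield :: "'k::field set \<Rightarrow> bool" where
  "is_subfield F \<longleftrightarrow> 0 \<in> F \<and> 1 \<in> F \<and>
     (\<forall>a\<in>F. \<forall>b\<in>F. a + b \<in> F) \<and> (\<forall>a\<in>F. - a \<in> F) \<and>
     (\<forall>a\<in>F. \<forall>b\<in>F. a * b \<in> F) \<and> (\<forall>a\<in>F. inverse a \<in> F)"

definition field_adjoin :: "'k::field set \<Rightarrow> 'k set \<Rightarrow> 'k set" where
  "field_adjoin M A = \<Inter>{F. is_subfield F \<and> M \<subseteq> F \<and> A \<subseteq> F}"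

definition algebraic_over :: "'k::field set \<Rightarrow> 'k \<Rightarrow> bool" where
  "algebraic_over F z \<longleftrightarrow> (\<exists>p. p \<noteq> 0 \<and> (\<forall>i. coeff p i \<in> F) \<and> poly p z = 0)"

text \<open>Only the values of \<open>\<sigma>\<close> on \<open>L\<close> matter here.\<close>

definition field_automorphism_over :: "'k::field set \<Rightarrow> 'k set \<Rightarrow> ('k \<Rightarrow> 'k) \<Rightarrow> bool" where
  "field_automorphism_over M L \<sigma> \<longleftrightarrow> bij_betw \<sigma> L L \<and> \<sigma> 1 = 1 \<and>
     (\<forall>a\<in>L. \<forall>b\<in>L. \<sigma> (a + b) = \<sigma> a + \<sigma> b) \<and>
     (\<forall>a\<in>L. \<forall>b\<in>L. \<sigma> (a * b) = \<sigma> a * \<sigma> b) \<and>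
     (\<forall>a\<in>M. \<sigma> a = a)"

definition galois_extension :: "'k::field set \<Rightarrow> 'k set \<Rightarrow> bool" where
  "galois_extension L M \<longleftrightarrow> is_subfield L \<and> is_subfield M \<and> M \<subseteq> L \<and>
     (\<forall>z\<in>L. algebraic_over M z) \<and>
     {z \<in> L. \<forall>\<sigma>. field_automorphism_over M L \<sigma> \<longrightarrow> \<sigma> z = z} = M"

definition field_embedding :: "('c::field \<Rightarrow> 'k::field) \<Rightarrow> bool" where
  "field_embedding \<iota> \<longleftrightarrow> \<iota> 1 = 1 \<and>
     (\<forall>a b. \<iota> (a + b) = \<iota> a + \<iota> b) \<and> (\<forall>a b. \<iota> (a * b) = \<iota> a * \<iota> b)"

text \<open>
  A polynomial in two variables is an element of \<open>'c poly poly\<close>: the coefficients are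
  polynomials in the first variable.
\<close>

definition algebraically_independent2 :: "('c::field \<Rightarrow> 'k::field) \<Rightarrow> 'k \<Rightarrow> 'k \<Rightarrow> bool" where
  "algebraically_independent2 \<iota> x y \<longleftrightarrow>
     (\<forall>P::'c poly poly. P \<noteq> 0 \<longrightarrow> poly (map_poly (\<lambda>q. poly (map_poly \<iota> q) x) P) y \<noteq> 0)"

text \<open>That \<open>'k\<close> is algebraically closed is expressed by its type class.\<close>

definition is_algebraic_closure_of :: "'k::alg_closed_field itself \<Rightarrow> 'k set \<Rightarrow> bool" where
  "is_algebraic_closure_of _ F \<longleftrightarrow> is_subfield F \<and> (\<forall>z::'k. algebraic_over F z)"

text \<open>
  Value at \<open>(u, v)\<close> of the Laurent polynomial with support \<open>S\<close> and weights \<open>w\<close>. It is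
  meaningful only where no negative power of zero occurs, which is what
  \<open>step_defined\<close> says (in HOL, negative powers of zero are zero).
\<close>

definition step_eval ::
  "('c::field \<Rightarrow> 'k::field) \<Rightarrow> (int \<times> int) set \<Rightarrow> (int \<times> int \<Rightarrow> 'c) \<Rightarrow> 'k \<Rightarrow> 'k \<Rightarrow> 'k" where
  "step_eval \<iota> S w u v = (\<Sum>(i, j)\<in>S. \<iota> (w (i, j)) * u powi i * v powi j)"

definition step_defined :: "(int \<times> int) set \<Rightarrow> 'k::field \<Rightarrow> 'k \<Rightarrow> bool" where
  "step_defined S u v \<longleftrightarrow> (\<forall>(i, j)\<in>S. (i < 0 \<longrightarrow> u \<noteq> 0) \<and> (j < 0 \<longrightarrow> v \<noteq> 0))"

definition same_step_value ::
  "('c::field \<Rightarrow> 'k::field) \<Rightarrow> (int \<times> int) set \<Rightarrow> (int \<times> int \<Rightarrow> 'c) \<Rightarrow> 'k \<times> 'k \<Rightarrow> 'k \<times> 'k \<Rightarrow> bool"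
where
  "same_step_value \<iota> S w p q \<longleftrightarrow>
     step_defined S (fst p) (snd p) \<and> step_defined S (fst q) (snd q) \<and>
     step_eval \<iota> S w (fst p) (snd p) = step_eval \<iota> S w (fst q) (snd q)"

definition sim_x ::
  "('c::field \<Rightarrow> 'k::field) \<Rightarrow> (int \<times> int) set \<Rightarrow> (int \<times> int \<Rightarrow> 'c) \<Rightarrow> 'k \<times> 'k \<Rightarrow> 'k \<times> 'k \<Rightarrow> bool"
where
  "sim_x \<iota> S w p q \<longleftrightarrow> fst p = fst q \<and> same_step_value \<iota> S w p q"

definition sim_y ::
  "('c::field \<Rightarrow> 'k::field) \<Rightarrow> (int \<times> int) set \<Rightarrow> (int \<times> int \<Rightarrow> 'c) \<Rightarrow> 'k \<times> 'k \<Rightarrow> 'k \<times> 'k \<Rightarrow> bool"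
where
  "sim_y \<iota> S w p q \<longleftrightarrow> snd p = snd q \<and> same_step_value \<iota> S w p q"

text \<open>Both relations are symmetric, so the closure below is an equivalence relation.\<close>

definition walk_orbit ::
  "('c::field \<Rightarrow> 'k::field) \<Rightarrow> (int \<times> int) set \<Rightarrow> (int \<times> int \<Rightarrow> 'c) \<Rightarrow> 'k \<Rightarrow> 'k \<Rightarrow> ('k \<times> 'k) set"
where
  "walk_orbit \<iota> S w x y = {q. (sup (sim_x \<iota> S w) (sim_y \<iota> S w))\<^sup>*\<^sup>* (x, y) q}"

definition base_field ::
  "('c::field \<Rightarrow> 'k::field) \<Rightarrow> (int \<times> int) set \<Rightarrow> (int \<times> int \<Rightarrow> 'c) \<Rightarrow> 'k \<Rightarrow> 'k \<Rightarrow> 'k set" where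
  "base_field \<iota> S w x y = field_adjoin (range \<iota>) {step_eval \<iota> S w x y}"

definition orbit_field ::
  "('c::field \<Rightarrow> 'k::field) \<Rightarrow> (int \<times> int) set \<Rightarrow> (int \<times> int \<Rightarrow> 'c) \<Rightarrow> 'k \<Rightarrow> 'k \<Rightarrow> 'k set" where
  "orbit_field \<iota> S w x y =
     field_adjoin (base_field \<iota> S w x y) (fst ` walk_orbit \<iota> S w x y \<union> snd ` walk_orbit \<iota> S w x y)"

end

theory Submission
  imports "HOL-Algebra.Algebraic_Closure_Type" Defs
begin

text \<open>
  Let \<open>L = k(O)\<close> and let \<open>M\<close> be one of \<open>k(x)\<close>, \<open>k(y)\<close>, \<open>k(x, y)\<close>. As \<open>S\<close> is not univariate, each
  of \<open>x\<close>, \<open>y\<close> is algebraic over \<open>k\<close> and the other one, so the whole algebraically closed field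
  is algebraic over \<open>M\<close>. In characteristic zero, every \<open>z \<notin> M\<close> is then moved by an embedding \<open>\<sigma>\<close> of
  the ambient field over \<open>M\<close>: send \<open>z\<close> to another root of its minimal polynomial and extend by
  Zorn's lemma. Since \<open>\<sigma>\<close> fixes \<open>S(x, y)\<close> and at least one of \<open>x\<close>, \<open>y\<close>, the pair \<open>(\<sigma> x, \<sigma> y)\<close> is
  adjacent to \<open>(x, y)\<close>; hence \<open>\<sigma>\<close> maps the orbit, and so \<open>L\<close>, into itself. It permutes the roots in
  \<open>L\<close> of every polynomial over \<open>M\<close> and thus restricts to an automorphism of \<open>L\<close>.
\<close>

section \<open>Subfields and field embeddings\<close>

lemma
  assumes "is_subfield F"
  shows is_subfield_0: "0 \<in> F"
    and is_subfield_1: "1 \<in> F"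
    and is_subfield_add: "a \<in> F \<Longrightarrow> b \<in> F \<Longrightarrow> a + b \<in> F"
    and is_subfield_uminus: "a \<in> F \<Longrightarrow> - a \<in> F"
    and is_subfield_mult: "a \<in> F \<Longrightarrow> b \<in> F \<Longrightarrow> a * b \<in> F"
    and is_subfield_inverse: "a \<in> F \<Longrightarrow> inverse a \<in> F"
  using assms unfolding is_subfield_def by auto

lemma is_subfield_diff: "is_subfield F \<Longrightarrow> a \<in> F \<Longrightarrow> b \<in> F \<Longrightarrow> a - b \<in> F"
  using is_subfield_add[of F a "- b"] is_subfield_uminus[of F b] by simp

lemma is_subfield_divide: "is_subfield F \<Longrightarrow> a \<in> F \<Longrightarrow> b \<in> F \<Longrightarrow> a / b \<in> F"
  by (simp add: divide_inverse is_subfield_mult is_subfield_inverse)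

lemma is_subfield_sum: "is_subfield F \<Longrightarrow> (\<And>i. i \<in> I \<Longrightarrow> f i \<in> F) \<Longrightarrow> sum f I \<in> F"
  by (induction I rule: infinite_finite_induct) (auto simp: is_subfield_0 is_subfield_add)

lemma is_subfield_power: "is_subfield F \<Longrightarrow> a \<in> F \<Longrightarrow> a ^ n \<in> F"
  by (induction n) (simp_all add: is_subfield_1 is_subfield_mult)

lemma is_subfield_power_int: "is_subfield F \<Longrightarrow> a \<in> F \<Longrightarrow> a powi i \<in> F"
  by (simp add: power_int_def is_subfield_inverse is_subfield_power)

lemma is_subfield_of_nat: "is_subfield F \<Longrightarrow> of_nat n \<in> F"
  by (induction n) (auto simp: is_subfield_0 is_subfield_1 is_subfield_add)

lemma is_subfield_field_adjoin: "is_subfield (field_adjoin M A)"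
  unfolding field_adjoin_def is_subfield_def by blast

lemma subset_field_adjoin: "M \<union> A \<subseteq> field_adjoin M A"
  unfolding field_adjoin_def by blast

lemma field_adjoin_least: "is_subfield F \<Longrightarrow> M \<union> A \<subseteq> F \<Longrightarrow> field_adjoin M A \<subseteq> F"
  unfolding field_adjoin_def by blast

context
  fixes f :: "'a::field \<Rightarrow> 'b::field"
  assumes f: "field_embedding f"
begin

lemma field_embedding_1: "f 1 = 1"
  and field_embedding_add: "f (a + b) = f a + f b"
  and field_embedding_mult: "f (a * b) = f a * f b"
  using f unfolding field_embedding_def by auto

lemma field_embedding_0: "f 0 = 0"
  using field_embedding_add[of 0 0] by (metis add.right_neutral add_left_imp_eq)

lemma field_embedding_uminus: "f (- a) = - f a"
  using field_embedding_add[of a "- a"] by (simp add: field_embedding_0 add_eq_0_iff)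

lemma field_embedding_inverse: "f (inverse a) = inverse (f a)"
proof (cases "a = 0")
  case False
  then have "f a * f (inverse a) = 1"
    by (simp add: field_embedding_1 flip: field_embedding_mult)
  then show ?thesis
    by (rule inverse_unique[symmetric])
qed (simp add: field_embedding_0)

lemma field_embedding_eq_0_iff: "f a = 0 \<longleftrightarrow> a = 0"
proof
  assume "f a = 0"
  then have "f (a * inverse a) = 0"
    by (simp add: field_embedding_mult)
  then show "a = 0"
    using field_embedding_1 by (cases "a = 0") auto
qed (simp add: field_embedding_0)

lemma inj_field_embedding: "inj f"
proof (rule injI)
  fix a b
  assume "f a = f b"
  then have "f (a + - b) = 0"
    by (simp only: field_embedding_add field_embedding_uminus right_minus)
  then show "a = b"
    by (simp add: field_embedding_eq_0_iff)
qed

lemma field_embedding_sum: "f (sum g I) = (\<Sum>i\<in>I. f (g i))"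
  by (induction I rule: infinite_finite_induct)
    (simp_all add: field_embedding_0 field_embedding_add)

lemma field_embedding_power: "f (a ^ n) = f a ^ n"
  by (induction n) (simp_all add: field_embedding_1 field_embedding_mult)

lemma field_embedding_power_int: "f (a powi i) = f a powi i"
  by (simp add: power_int_def field_embedding_power field_embedding_inverse)

lemma field_embedding_poly: "f (poly p a) = poly (map_poly f p) (f a)"
  by (induction p)
    (simp_all add: map_poly_pCons field_embedding_0 field_embedding_add field_embedding_mult)

lemma CHAR_field_embedding: "CHAR('b) = CHAR('a)"
proof (rule CHAR_eqI)
  have f_of_nat: "f (of_nat n) = of_nat n" for n
    by (induction n) (simp_all add: field_embedding_0 field_embedding_1 field_embedding_add)
  show "of_nat CHAR('a) = (0 :: 'b)"
    by (simp add: field_embedding_0 flip: f_of_nat)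
  show "CHAR('a) dvd n" if "of_nat n = (0 :: 'b)" for n
    using that by (simp add: field_embedding_eq_0_iff flip: f_of_nat of_nat_eq_0_iff_char_dvd)
qed

lemma is_subfield_vimage: "is_subfield F \<Longrightarrow> is_subfield (f -` F)"
  unfolding is_subfield_def
  by (simp add: field_embedding_0 field_embedding_1 field_embedding_add field_embedding_uminus
      field_embedding_mult field_embedding_inverse)

lemma image_field_adjoin_subset:
  assumes "is_subfield F" "f ` (M \<union> A) \<subseteq> F"
  shows "f ` field_adjoin M A \<subseteq> F"
  using field_adjoin_least[OF is_subfield_vimage[OF assms(1)], of M A] assms(2) by blast

lemma is_subfield_range: "is_subfield (range f)"
  unfolding is_subfield_def
  using field_embedding_0[symmetric] field_embedding_1[symmetric]
  by (auto simp flip: field_embedding_add field_embedding_uminus field_embedding_mult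
      field_embedding_inverse)

end

section \<open>Algebraic elements\<close>

lemma algebraic_over_mono: "algebraic_over F z \<Longrightarrow> F \<subseteq> G \<Longrightarrow> algebraic_over G z"
  unfolding algebraic_over_def by blast

lemma algebraic_over_mem:
  assumes "is_subfield F" "a \<in> F"
  shows "algebraic_over F a"
  unfolding algebraic_over_def using assms
  by (intro exI[of _ "[:- a, 1:]"])
    (auto simp: coeff_pCons is_subfield_0 is_subfield_1 is_subfield_uminus split: nat.split)

lemma transcendental_nonzero:
  assumes "is_subfield F" "\<not> algebraic_over F a"
  shows "a \<noteq> 0"
  using assms algebraic_over_mem[OF assms(1) is_subfield_0[OF assms(1)]] by blast

lemma algebraic_over_range_iff:
  assumes \<iota>: "field_embedding \<iota>"
  shows "algebraic_over (range \<iota>) z \<longleftrightarrow> (\<exists>q. q \<noteq> 0 \<and> poly (map_poly \<iota> q) z = 0)"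
proof
  assume "algebraic_over (range \<iota>) z"
  then obtain p where p: "p \<noteq> 0" "\<And>i. coeff p i \<in> range \<iota>" "poly p z = 0"
    unfolding algebraic_over_def by blast
  define q where "q = map_poly (inv_into UNIV \<iota>) p"
  have "inv_into UNIV \<iota> 0 = 0"
    using inv_into_f_f[OF inj_field_embedding[OF \<iota>], of 0] by (simp add: field_embedding_0[OF \<iota>])
  then have "map_poly \<iota> q = p"
    using p(2) by (intro poly_eqI)
      (simp add: q_def coeff_map_poly field_embedding_0[OF \<iota>] f_inv_into_f)
  then show "\<exists>q. q \<noteq> 0 \<and> poly (map_poly \<iota> q) z = 0"
    using p(1,3) by (intro exI[of _ q]) auto
next
  assume "\<exists>q. q \<noteq> 0 \<and> poly (map_poly \<iota> q) z = 0"
  then obtain q where "q \<noteq> 0" "poly (map_poly \<iota> q) z = 0"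
    by blast
  then show "algebraic_over (range \<iota>) z"
    unfolding algebraic_over_def
    by (intro exI[of _ "map_poly \<iota> q"])
      (simp add: map_poly_eq_0_iff coeff_map_poly field_embedding_eq_0_iff[OF \<iota>]
        field_embedding_0[OF \<iota>])
qed

lemma set_coeffs_subset_iff:
  "is_subfield F \<Longrightarrow> set (coeffs p) \<subseteq> F \<longleftrightarrow> (\<forall>i. coeff p i \<in> F)"
  using forall_coeffs_conv[of "\<lambda>a. a \<in> F" p] by (simp add: is_subfield_0 subset_eq)

context
  fixes R :: "'k::field ring"
  defines "R \<equiv> ring_of_type_algebra"
begin

interpretation R: field R
  unfolding R_def by (rule field_from_type_algebra)

lemma ring_of_type_algebra_simps:
  "carrier R = UNIV" "\<zero>\<^bsub>R\<^esub> = 0" "\<one>\<^bsub>R\<^esub> = 1" "a \<oplus>\<^bsub>R\<^esub> b = a + b" "a \<otimes>\<^bsub>R\<^esub> b = a * b"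
  "\<ominus>\<^bsub>R\<^esub> a = - a" "a \<noteq> 0 \<Longrightarrow> inv\<^bsub>R\<^esub> a = inverse a" "a [^]\<^bsub>R\<^esub> (n :: nat) = a ^ n"
proof -
  show R_simps: "carrier R = UNIV" "\<zero>\<^bsub>R\<^esub> = 0" "\<one>\<^bsub>R\<^esub> = 1" "a \<oplus>\<^bsub>R\<^esub> b = a + b" "a \<otimes>\<^bsub>R\<^esub> b = a * b"
    for a b
    by (simp_all add: R_def ring_of_type_algebra_def)
  show "\<ominus>\<^bsub>R\<^esub> a = - a"
    by (rule R.minus_equality) (simp_all add: R_simps)
  show "inv\<^bsub>R\<^esub> a = inverse a" if "a \<noteq> 0"
    by (rule R.comm_inv_char) (simp_all add: R_simps that)
  show "a [^]\<^bsub>R\<^esub> n = a ^ n"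
    by (induction n) (simp_all add: R_simps)
qed

lemma is_subfield_iff_subfield: "is_subfield F \<longleftrightarrow> subfield F R"
proof
  assume F: "is_subfield F"
  show "subfield F R"
  proof (rule R.subfieldI')
    show "subring F R"
      using F by (intro R.subringI) (simp_all add: is_subfield_def ring_of_type_algebra_simps)
    show "inv\<^bsub>R\<^esub> a \<in> F" if "a \<in> F - {\<zero>\<^bsub>R\<^esub>}" for a
      using that F by (simp add: is_subfield_inverse ring_of_type_algebra_simps)
  qed
next
  assume F: "subfield F R"
  note F_closed = subringE[OF subfieldE(1)[OF F], unfolded ring_of_type_algebra_simps]
  have "inverse a \<in> F" if "a \<in> F" for a
  proof (cases "a = 0")
    case False
    then show ?thesis
      using R.subfield_m_inv(1)[OF F, of a] that by (simp add: ring_of_type_algebra_simps)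
  qed (use that in simp)
  then show "is_subfield F"
    unfolding is_subfield_def using F_closed by simp
qed

lemma eval_rev_coeffs: "R.eval (rev (coeffs p)) a = poly p a"
proof -
  have "R.eval xs a = poly (Poly (rev xs)) a" for xs
    by (induction xs) (simp_all add: ring_of_type_algebra_simps Poly_append poly_monom)
  then show ?thesis
    by simp
qed

lemma algebraic_over_iff:
  assumes F: "is_subfield F"
  shows "algebraic_over F z \<longleftrightarrow> (R.algebraic over F) z"
proof
  assume "algebraic_over F z"
  then obtain p where p: "p \<noteq> 0" "set (coeffs p) \<subseteq> F" "poly p z = 0"
    unfolding algebraic_over_def set_coeffs_subset_iff[OF F, symmetric] by blast
  then have "rev (coeffs p) \<in> carrier (F[X]\<^bsub>R\<^esub>)"
    by (simp add: univ_poly_def polynomial_def hd_rev last_coeffs_eq_coeff_degree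
        ring_of_type_algebra_simps)
  then show "(R.algebraic over F) z"
    by (rule R.algebraicI) (simp_all add: p eval_rev_coeffs ring_of_type_algebra_simps)
next
  assume z: "(R.algebraic over F) z"
  have "subring F R"
    using F by (simp add: is_subfield_iff_subfield subfieldE(1))
  then obtain xs where xs: "xs \<in> carrier (F[X]\<^bsub>R\<^esub>)" "xs \<noteq> []" "R.eval xs z = 0"
    using R.algebraicE[OF _ _ z] unfolding ring_of_type_algebra_simps by blast
  then have F_xs: "set xs \<subseteq> F" and "hd xs \<noteq> 0"
    by (simp_all add: univ_poly_def polynomial_def ring_of_type_algebra_simps)
  define p where "p = Poly (rev xs)"
  have "xs = rev (coeffs p)"
    using xs(2) \<open>hd xs \<noteq> 0\<close> by (cases xs) (simp_all add: p_def)
  then have "p \<noteq> 0" "set (coeffs p) \<subseteq> F" "poly p z = 0"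
    using xs(2,3) F_xs eval_rev_coeffs[of p z] by auto
  then show "algebraic_over F z"
    unfolding algebraic_over_def set_coeffs_subset_iff[OF F, symmetric] by blast
qed

lemma is_subfield_algebraic_elements:
  fixes F :: "'k set"
  assumes "is_subfield F"
  shows "is_subfield {a. algebraic_over F a}"
  using R.subfield_of_algebraics[of F] assms
  by (simp add: is_subfield_iff_subfield algebraic_over_iff ring_of_type_algebra_simps)

lemma algebraic_over_finite_dimension_trans:
  assumes F: "is_subfield F" and E: "is_subfield E" and finite: "R.finite_dimension F E"
    and z: "algebraic_over E z"
  shows "algebraic_over F z"
proof -
  let ?Ez = "R.simple_extension E z"
  note subfields = F[unfolded is_subfield_iff_subfield] E[unfolded is_subfield_iff_subfield]
  have carrier: "z \<in> carrier R"
    by (simp add: ring_of_type_algebra_simps)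
  have "R.finite_dimension E ?Ez"
    using R.finite_dimension_simple_extension[OF subfields(2) carrier] z
    by (simp add: algebraic_over_iff[OF E])
  then have "R.finite_dimension F ?Ez"
    by (rule R.telescopic_base_dim(1)[OF subfields finite])
  moreover have "subring ?Ez R" "z \<in> ?Ez"
    using R.simple_extension_is_subring R.simple_extension_mem subfieldE(1)[OF subfields(2)] carrier
    by simp_all
  ultimately show ?thesis
    using R.finite_dimension_imp_algebraic[OF subfields(1)] algebraic_over_iff[OF F] by blast
qed

lemma algebraic_over_trans:
  fixes F :: "'k set"
  assumes F: "is_subfield F" and E: "\<And>a. a \<in> E \<Longrightarrow> algebraic_over F a"
    and z: "algebraic_over E z"
  shows "algebraic_over F z"
proof -
  have F_subfield: "subfield F R"
    using F by (simp add: is_subfield_iff_subfield)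
  obtain p where p: "p \<noteq> 0" "\<forall>i. coeff p i \<in> E" "poly p z = 0"
    using z unfolding algebraic_over_def by blast
  define F' where "F' = R.finite_extension F (coeffs p)"
  have carrier: "set (coeffs p) \<subseteq> carrier R"
    by (simp add: ring_of_type_algebra_simps)
  have coeffs_algebraic: "(R.algebraic over F) a" if "a \<in> set (coeffs p)" for a
  proof -
    have "a \<in> range (coeff p)"
      using that by (simp add: range_coeff)
    then show ?thesis
      using p(2) E by (auto simp flip: algebraic_over_iff[OF F])
  qed
  have F': "is_subfield F'"
    unfolding F'_def is_subfield_iff_subfield
    by (rule R.finite_extension_is_subfield[OF F_subfield carrier coeffs_algebraic])
  have "set (coeffs p) \<subseteq> F'"
    unfolding F'_def by (rule R.finite_extension_mem[OF subfieldE(1)[OF F_subfield] carrier])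
  then have "algebraic_over F' z"
    using p(1,3) unfolding algebraic_over_def set_coeffs_subset_iff[OF F'] by blast
  moreover have "R.finite_dimension F F'"
    unfolding F'_def
    by (rule R.finite_extension_finite_dimension(1)[OF F_subfield carrier coeffs_algebraic])
  ultimately show ?thesis
    using algebraic_over_finite_dimension_trans[OF F F'] by blast
qed

end

lemma algebraic_over_field_adjoin_trans:
  assumes F: "is_subfield F" and "\<And>a. a \<in> M \<union> A \<Longrightarrow> algebraic_over F a"
    and z: "algebraic_over (field_adjoin M A) z"
  shows "algebraic_over F z"
proof (rule algebraic_over_trans[OF F _ z])
  have "field_adjoin M A \<subseteq> {a. algebraic_over F a}"
    using assms(2) by (intro field_adjoin_least is_subfield_algebraic_elements[OF F]) blast
  then show "algebraic_over F a" if "a \<in> field_adjoin M A" for a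
    using that by blast
qed

section \<open>Minimal annihilators\<close>

definition annihilates :: "'k::field set \<Rightarrow> 'k poly \<Rightarrow> 'k \<Rightarrow> bool" where
  "annihilates F p a \<longleftrightarrow> p \<noteq> 0 \<and> (\<forall>i. coeff p i \<in> F) \<and> poly p a = 0"

definition minimal_annihilator :: "'k::field set \<Rightarrow> 'k poly \<Rightarrow> 'k \<Rightarrow> bool" where
  "minimal_annihilator F p a \<longleftrightarrow>
     annihilates F p a \<and> (\<forall>q. annihilates F q a \<longrightarrow> degree p \<le> degree q)"

lemma annihilates_degree_pos:
  assumes "annihilates F p a"
  shows "degree p > 0"
proof (rule ccontr)
  assume "\<not> degree p > 0"
  then obtain c where "p = [:c:]"
    using degree_eq_zeroE[of p] by auto
  then show False
    using assms unfolding annihilates_def by auto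
qed

lemma annihilates_nonzero_constant_coeff:
  assumes F: "is_subfield F" and "algebraic_over F a" "a \<noteq> 0"
  obtains p where "annihilates F p a" "coeff p 0 \<noteq> 0"
proof -
  obtain p where p: "p \<noteq> 0" "\<forall>i. coeff p i \<in> F" "poly p a = 0"
    using assms(2) unfolding algebraic_over_def by blast
  \<comment> \<open>reflecting twice strips the largest power of the indeterminate\<close>
  let ?q = "reflect_poly (reflect_poly p)"
  have "poly (reflect_poly p) (inverse a) = 0"
    using assms(3) p(3) by (simp add: poly_reflect_poly_nz)
  then have "poly ?q a = 0"
    using assms(3) by (simp add: poly_reflect_poly_nz)
  then have "annihilates F ?q a"
    using p(1,2) is_subfield_0[OF F] by (simp add: annihilates_def coeff_reflect_poly)
  then show thesis
    using p(1) by (intro that[of ?q]) simp_all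
qed

lemma minimal_annihilator_exists:
  assumes "algebraic_over F a"
  obtains p where "minimal_annihilator F p a"
proof -
  have "\<exists>p. annihilates F p a"
    using assms unfolding algebraic_over_def annihilates_def .
  then have "\<exists>p. minimal_annihilator F p a"
    unfolding minimal_annihilator_def
    using ex_has_least_nat[of "\<lambda>p. annihilates F p a" _ degree] by metis
  then show thesis
    using that by blast
qed

lemma
  assumes "minimal_annihilator F p a"
  shows minimal_annihilator_nonzero: "p \<noteq> 0"
    and minimal_annihilator_coeff_mem: "coeff p i \<in> F"
    and minimal_annihilator_root: "poly p a = 0"
    and minimal_annihilator_degree_pos: "degree p > 0"
    and minimal_annihilator_degree_le: "annihilates F q a \<Longrightarrow> degree p \<le> degree q"
  using assms annihilates_degree_pos unfolding minimal_annihilator_def annihilates_def by blast+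

lemma annihilates_linear_imp_mem:
  assumes "is_subfield F" "annihilates F p a" "degree p = 1"
  shows "a \<in> F"
proof -
  obtain b c where p: "p = [:b, c:]" "c \<noteq> 0"
    using degree1_coeffs[OF assms(3)] by blast
  then have "coeff p 0 = b" "coeff p 1 = c"
    by simp_all
  then have "b \<in> F" "c \<in> F"
    using assms(2) unfolding annihilates_def by metis+
  moreover have "a = - (b / c)"
    using assms(2) p by (simp add: annihilates_def field_simps eq_neg_iff_add_eq_0)
  ultimately show ?thesis
    using assms(1) by (simp add: is_subfield_uminus is_subfield_divide)
qed

lemma minimal_annihilator_simple_root:
  fixes a :: "'k::field"
  assumes "CHAR('k) = 0" and F: "is_subfield F" and m: "minimal_annihilator F m a"
  shows "poly (pderiv m) a \<noteq> 0"
proof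
  assume root: "poly (pderiv m) a = 0"
  note degree_pos = minimal_annihilator_degree_pos[OF m]
  have "coeff (pderiv m) (degree m - 1) = of_nat (degree m) * lead_coeff m"
    using degree_pos by (simp add: coeff_pderiv del: of_nat_Suc)
  also have "\<dots> \<noteq> 0"
    using degree_pos assms(1) by (auto simp: of_nat_eq_0_iff_char_dvd)
  finally have "pderiv m \<noteq> 0"
    by auto
  moreover have "coeff (pderiv m) i \<in> F" for i
    unfolding coeff_pderiv
    by (intro is_subfield_mult[OF F] is_subfield_of_nat[OF F] minimal_annihilator_coeff_mem[OF m])
  ultimately have "degree m \<le> degree (pderiv m)"
    using root by (intro minimal_annihilator_degree_le[OF m]) (simp add: annihilates_def)
  moreover have "degree (pderiv m) \<le> degree m - 1"
    by (rule degree_le) (auto simp: coeff_pderiv coeff_eq_0)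
  ultimately show False
    using degree_pos by simp
qed

lemma simple_root_not_unique_root:
  fixes a :: "'k::alg_closed_field"
  assumes "poly p a = 0" "poly (pderiv p) a \<noteq> 0" "degree p > 1"
  obtains b where "b \<noteq> a" "poly p b = 0"
proof -
  obtain q where q: "p = [:- a, 1:] * q"
    using assms(1) poly_eq_0_iff_dvd by (metis dvdE)
  have "q \<noteq> 0"
    using assms(3) q by auto
  then have "degree p = Suc (degree q)"
    unfolding q by (subst degree_mult_eq) auto
  then obtain b where b: "poly q b = 0"
    using assms(3) alg_closed_imp_poly_has_root[of q] by auto
  moreover have "poly q a = poly (pderiv p) a"
    unfolding q pderiv_mult by (simp add: pderiv_pCons)
  ultimately show thesis
    using assms(2) q by (intro that[of b]) auto
qed

section \<open>Extension of partial embeddings\<close>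

definition rel_poly :: "('a::zero \<times> 'b::zero) set \<Rightarrow> 'a poly \<Rightarrow> 'b poly \<Rightarrow> bool" where
  "rel_poly G p q \<longleftrightarrow> (\<forall>i. (coeff p i, coeff q i) \<in> G)"

text \<open>
  A partial embedding over \<open>M\<close> is given by its graph. Its domain is only required to be a subring;
  if its elements are algebraic over \<open>M\<close>, it is automatically a field.
\<close>

locale partial_embedding =
  fixes M :: "'k::field set" and G :: "('k \<times> 'k) set"
  assumes is_subfield: "is_subfield M"
    and fixes_base: "a \<in> M \<Longrightarrow> (a, a) \<in> G"
    and functional: "(a, b) \<in> G \<Longrightarrow> (a, c) \<in> G \<Longrightarrow> b = c"
    and add: "(a, b) \<in> G \<Longrightarrow> (c, d) \<in> G \<Longrightarrow> (a + c, b + d) \<in> G"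
    and mult: "(a, b) \<in> G \<Longrightarrow> (c, d) \<in> G \<Longrightarrow> (a * c, b * d) \<in> G"
begin

lemma zero: "(0, 0) \<in> G" and one: "(1, 1) \<in> G"
  by (simp_all add: fixes_base is_subfield_0 is_subfield_1 is_subfield)

lemma diff:
  assumes "(a, b) \<in> G" "(c, d) \<in> G"
  shows "(a - c, b - d) \<in> G"
proof -
  have "(- 1, - 1) \<in> G"
    by (simp add: fixes_base is_subfield_uminus is_subfield_1 is_subfield)
  from add[OF assms(1) mult[OF this assms(2)]] show ?thesis
    by simp
qed

lemma sum: "(\<And>i. i \<in> I \<Longrightarrow> (f i, g i) \<in> G) \<Longrightarrow> (\<Sum>i\<in>I. f i, \<Sum>i\<in>I. g i) \<in> G"
  by (induction I rule: infinite_finite_induct) (simp_all add: zero add)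

lemma power: "(a, b) \<in> G \<Longrightarrow> (a ^ n, b ^ n) \<in> G"
  by (induction n) (simp_all add: one mult)

lemma poly:
  assumes "\<And>i. coeff p i \<in> M" "(a, b) \<in> G"
  shows "(poly p a, poly p b) \<in> G"
  unfolding poly_altdef by (intro sum mult power fixes_base assms)

lemma rel_poly_pCons: "(a, b) \<in> G \<Longrightarrow> rel_poly G p q \<Longrightarrow> rel_poly G (pCons a p) (pCons b q)"
  unfolding rel_poly_def by (auto simp: coeff_pCons split: nat.split)

lemma rel_poly_0: "rel_poly G 0 0"
  by (simp add: rel_poly_def zero)

lemma rel_poly_add: "rel_poly G p q \<Longrightarrow> rel_poly G r s \<Longrightarrow> rel_poly G (p + r) (q + s)"
  by (simp add: rel_poly_def add)

lemma rel_poly_diff: "rel_poly G p q \<Longrightarrow> rel_poly G r s \<Longrightarrow> rel_poly G (p - r) (q - s)"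
  by (simp add: rel_poly_def diff)

lemma rel_poly_mult: "rel_poly G p q \<Longrightarrow> rel_poly G r s \<Longrightarrow> rel_poly G (p * r) (q * s)"
  unfolding rel_poly_def coeff_mult by (simp add: sum mult)

lemma rel_poly_smult: "(a, b) \<in> G \<Longrightarrow> rel_poly G p q \<Longrightarrow> rel_poly G (smult a p) (smult b q)"
  by (simp add: rel_poly_def mult)

lemma rel_poly_monom: "(a, b) \<in> G \<Longrightarrow> rel_poly G (monom a n) (monom b n)"
  by (simp add: rel_poly_def zero)

lemma rel_poly_0_left:
  assumes "rel_poly G 0 q"
  shows "q = 0"
  using assms functional[OF zero] by (intro poly_eqI) (auto simp: rel_poly_def)

lemma eq_0_iff:
  assumes "(a, b) \<in> G" "algebraic_over M a"
  shows "b = 0 \<longleftrightarrow> a = 0"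
proof
  show "b = 0" if "a = 0"
    using functional[OF zero] assms(1) that by blast
  show "a = 0" if "b = 0"
  proof (rule ccontr)
    assume "a \<noteq> 0"
    then obtain p where p: "annihilates M p a" "coeff p 0 \<noteq> 0"
      using annihilates_nonzero_constant_coeff[OF is_subfield assms(2)] by blast
    then have "(0, poly p b) \<in> G"
      using poly[of p, OF _ assms(1)] by (simp add: annihilates_def)
    then have "poly p 0 = 0"
      using functional[OF zero] that by metis
    then show False
      using p(2) by (simp add: poly_0_coeff_0)
  qed
qed

end

lemma degree_cancel_lead_coeff_less:
  fixes p m :: "'a::idom poly"
  assumes "degree m \<le> degree p" "degree m > 0"
  shows "degree (smult (lead_coeff m) p - monom (lead_coeff p) (degree p - degree m) * m)
    < degree p"
proof (rule degree_lessI)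
  let ?s = "monom (lead_coeff p) (degree p - degree m) * m"
  have "degree ?s \<le> degree p"
    using degree_mult_le[of "monom (lead_coeff p) (degree p - degree m)" m]
      degree_monom_le[of "lead_coeff p" "degree p - degree m"] assms(1) by simp
  then have "coeff ?s k = 0" if "k > degree p" for k
    using that by (simp add: coeff_eq_0)
  moreover have "coeff ?s (degree p) = lead_coeff p * lead_coeff m"
    using assms(1) by (simp add: coeff_monom_mult)
  ultimately show "\<forall>k\<ge>degree p. coeff (smult (lead_coeff m) p - ?s) k = 0"
    by (auto simp: coeff_eq_0 le_less)
qed (use assms in auto)

context partial_embedding
begin

context
  fixes m m' a b
  assumes algebraic: "\<And>c. c \<in> Domain G \<Longrightarrow> algebraic_over M c"
    and m: "minimal_annihilator (Domain G) m a" "rel_poly G m m'" "poly m' b = 0"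
begin

text \<open>
  Pseudo-division of \<open>p\<close> by \<open>m\<close>, carried out in parallel on the images: \<open>Domain G\<close> need not be
  closed under inverses.
\<close>

lemma rel_poly_root_transfer:
  assumes "rel_poly G p q" "poly p a = 0"
  shows "poly q b = 0"
  using assms
proof (induction "degree p" arbitrary: p q rule: less_induct)
  case less
  show ?case
  proof (cases "p = 0")
    case True
    then show ?thesis
      using rel_poly_0_left[of q] less.prems(1) by simp
  next
    case False
    then have "annihilates (Domain G) p a"
      using less.prems unfolding annihilates_def rel_poly_def by blast
    then have deg: "degree m \<le> degree p"
      by (rule minimal_annihilator_degree_le[OF m(1)])
    define c c' where "c = lead_coeff m" and "c' = coeff m' (degree m)"
    define l l' where "l = lead_coeff p" and "l' = coeff q (degree p)"
    define n where "n = degree p - degree m"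
    have lead: "(c, c') \<in> G" "(l, l') \<in> G"
      using m(2) less.prems(1) unfolding c_def c'_def l_def l'_def rel_poly_def by blast+
    have "c' \<noteq> 0"
      using eq_0_iff[OF lead(1) algebraic] lead(1) minimal_annihilator_nonzero[OF m(1)]
      by (auto simp: c_def)
    have "poly (smult c' q - monom l' n * m') b = 0"
    proof (rule less.hyps)
      show "degree (smult c p - monom l n * m) < degree p"
        unfolding c_def l_def n_def
        by (rule degree_cancel_lead_coeff_less[OF deg minimal_annihilator_degree_pos[OF m(1)]])
      show "rel_poly G (smult c p - monom l n * m) (smult c' q - monom l' n * m')"
        by (intro rel_poly_diff rel_poly_smult rel_poly_mult rel_poly_monom lead m(2) less.prems(1))
      show "poly (smult c p - monom l n * m) a = 0"
        using less.prems(2) minimal_annihilator_root[OF m(1)] by simp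
    qed
    then show ?thesis
      using \<open>c' \<noteq> 0\<close> m(3) by simp
  qed
qed

lemma rel_poly_value_functional:
  assumes "rel_poly G p q" "rel_poly G r s" "poly p a = poly r a"
  shows "poly q b = poly s b"
  using rel_poly_root_transfer[OF rel_poly_diff[OF assms(1,2)]] assms(3) by simp

lemma extend_by_root:
  obtains H where "partial_embedding M H" "G \<subseteq> H" "(a, b) \<in> H"
proof -
  define H where "H = {(poly p a, poly q b) |p q. rel_poly G p q}"
  have GH: "G \<subseteq> H"
  proof safe
    fix c d assume "(c, d) \<in> G"
    then have "rel_poly G [:c:] [:d:]"
      by (intro rel_poly_pCons rel_poly_0)
    then show "(c, d) \<in> H"
      unfolding H_def by force
  qed
  have "partial_embedding M H"
  proof
    show "(c, c) \<in> H" if "c \<in> M" for c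
      using GH fixes_base[OF that] by blast
    show "d = e" if "(c, d) \<in> H" "(c, e) \<in> H" for c d e
      using that rel_poly_value_functional unfolding H_def by auto
    fix c d e f assume "(c, d) \<in> H" "(e, f) \<in> H"
    then obtain p q r s where "rel_poly G p q" "rel_poly G r s"
      and eqs: "c = poly p a" "d = poly q b" "e = poly r a" "f = poly s b"
      unfolding H_def by blast
    then have "rel_poly G (p + r) (q + s)" "rel_poly G (p * r) (q * s)"
      by (simp_all add: rel_poly_add rel_poly_mult)
    then have "(poly (p + r) a, poly (q + s) b) \<in> H" "(poly (p * r) a, poly (q * s) b) \<in> H"
      unfolding H_def by blast+
    then show "(c + e, d + f) \<in> H" "(c * e, d * f) \<in> H"
      by (simp_all add: eqs)
  qed (rule is_subfield)
  moreover have "rel_poly G [:0, 1:] [:0, 1:]"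
    by (intro rel_poly_pCons rel_poly_0 zero one)
  then have "(a, b) \<in> H"
    unfolding H_def by force
  ultimately show thesis
    using that GH by blast
qed

end

end

lemma partial_embedding_extend_to_element:
  fixes M :: "'k::alg_closed_field set"
  assumes "partial_embedding M G" and algebraic: "\<And>c. algebraic_over M c"
  obtains H where "partial_embedding M H" "G \<subseteq> H" "a \<in> Domain H"
proof -
  interpret partial_embedding M G by fact
  have "M \<subseteq> Domain G"
    using fixes_base by blast
  then obtain m where m: "minimal_annihilator (Domain G) m a"
    using minimal_annihilator_exists algebraic_over_mono[OF algebraic] by blast
  obtain h where h: "\<And>i. (coeff m i, h i) \<in> G"
    using minimal_annihilator_coeff_mem[OF m] unfolding Domain_iff by metis
  have h_eq_0_iff: "h i = 0 \<longleftrightarrow> coeff m i = 0" for i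
    by (rule eq_0_iff[OF h algebraic])
  define m' where "m' = Poly (map h [0..<Suc (degree m)])"
  have coeff_m': "coeff m' i = h i" for i
    using h_eq_0_iff[of i] coeff_eq_0[of m i]
    by (auto simp: m'_def nth_default_def simp del: upt_Suc)
  then have "rel_poly G m m'"
    unfolding rel_poly_def using h by simp
  moreover have "degree m' = degree m"
    unfolding degree_def coeff_m' h_eq_0_iff ..
  then obtain b where "poly m' b = 0"
    using alg_closed_imp_poly_has_root[of m'] minimal_annihilator_degree_pos[OF m] by auto
  ultimately obtain H where "partial_embedding M H" "G \<subseteq> H" "(a, b) \<in> H"
    using extend_by_root[OF algebraic m] by blast
  then show thesis
    using that by blast
qed

lemma partial_embedding_Id_on: "is_subfield M \<Longrightarrow> partial_embedding M (Id_on M)"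
  by unfold_locales (auto simp: is_subfield_add is_subfield_mult)

lemma partial_embedding_Union_chain:
  assumes "\<C> \<noteq> {}" and chain: "subset.chain {G. partial_embedding M G} \<C>"
  shows "partial_embedding M (\<Union>\<C>)"
proof -
  have \<C>: "partial_embedding M G" if "G \<in> \<C>" for G
    using chain that unfolding subset_chain_def by blast
  have common: "\<exists>G\<in>\<C>. p \<in> G \<and> q \<in> G" if "p \<in> \<Union>\<C>" "q \<in> \<Union>\<C>" for p q
    using that chain unfolding subset_chain_def by (meson UnionE subsetD)
  obtain G where "G \<in> \<C>"
    using assms(1) by blast
  show ?thesis
  proof
    show "is_subfield M"
      using \<C>[OF \<open>G \<in> \<C>\<close>] by (rule partial_embedding.is_subfield)
    show "(a, a) \<in> \<Union>\<C>" if "a \<in> M" for a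
      using \<C>[OF \<open>G \<in> \<C>\<close>] \<open>G \<in> \<C>\<close> partial_embedding.fixes_base that by blast
    show "b = c" if "(a, b) \<in> \<Union>\<C>" "(a, c) \<in> \<Union>\<C>" for a b c
      using common[OF that] \<C> partial_embedding.functional by blast
    show "(a + c, b + d) \<in> \<Union>\<C>" "(a * c, b * d) \<in> \<Union>\<C>"
      if "(a, b) \<in> \<Union>\<C>" "(c, d) \<in> \<Union>\<C>" for a b c d
      using common[OF that] \<C> partial_embedding.add partial_embedding.mult by blast+
  qed
qed

lemma (in partial_embedding) maximal_extension:
  obtains H where "partial_embedding M H" "G \<subseteq> H"
    and "\<And>H'. partial_embedding M H' \<Longrightarrow> H \<subseteq> H' \<Longrightarrow> H' = H"
proof -
  let ?\<E> = "{H. partial_embedding M H \<and> G \<subseteq> H}"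
  have "\<exists>H\<in>?\<E>. \<forall>H'\<in>?\<E>. H \<subseteq> H' \<longrightarrow> H' = H"
  proof (rule subset_Zorn_nonempty)
    show "?\<E> \<noteq> {}"
      using partial_embedding_axioms by blast
    fix \<C>
    assume "\<C> \<noteq> {}" and chain: "subset.chain ?\<E> \<C>"
    moreover have "subset.chain {H. partial_embedding M H} \<C>"
      using chain unfolding subset_chain_def by blast
    moreover have "G \<subseteq> \<Union>\<C>"
      using \<open>\<C> \<noteq> {}\<close> chain unfolding subset_chain_def by blast
    ultimately show "\<Union>\<C> \<in> ?\<E>"
      using partial_embedding_Union_chain by blast
  qed
  then obtain H where "partial_embedding M H" "G \<subseteq> H"
    and "\<forall>H'\<in>?\<E>. H \<subseteq> H' \<longrightarrow> H' = H"
    by blast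
  then show thesis
    by (intro that[of H]) auto
qed

lemma partial_embedding_total_extension:
  fixes M :: "'k::alg_closed_field set"
  assumes "partial_embedding M G" and algebraic: "\<And>c. algebraic_over M c"
  obtains \<sigma> where "field_embedding \<sigma>" "\<And>a b. (a, b) \<in> G \<Longrightarrow> \<sigma> a = b"
proof -
  obtain H where H: "partial_embedding M H" "G \<subseteq> H"
    and maximal: "\<And>H'. partial_embedding M H' \<Longrightarrow> H \<subseteq> H' \<Longrightarrow> H' = H"
    using partial_embedding.maximal_extension[OF assms(1)] by blast
  interpret H: partial_embedding M H by fact
  have "a \<in> Domain H" for a
  proof -
    obtain H' where "partial_embedding M H'" "H \<subseteq> H'" "a \<in> Domain H'"
      using partial_embedding_extend_to_element[OF H(1) algebraic] .
    then show ?thesis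
      using maximal by metis
  qed
  then obtain \<sigma> where \<sigma>: "\<And>a. (a, \<sigma> a) \<in> H"
    unfolding Domain_iff by metis
  have eq: "\<sigma> a = b" if "(a, b) \<in> H" for a b
    using H.functional[OF \<sigma> that] .
  have "field_embedding \<sigma>"
    unfolding field_embedding_def by (intro conjI allI eq H.one H.add H.mult \<sigma>)
  then show thesis
    using that eq H(2) by blast
qed

section \<open>Galois extensions\<close>

lemma field_embedding_image_eq:
  assumes \<sigma>: "field_embedding \<sigma>" "\<And>a. a \<in> M \<Longrightarrow> \<sigma> a = a"
    and L: "\<sigma> ` L \<subseteq> L" "\<And>a. a \<in> L \<Longrightarrow> algebraic_over M a"
  shows "\<sigma> ` L = L"
proof (rule antisym[OF L(1)], rule subsetI)
  fix a
  assume "a \<in> L"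
  then obtain p where p: "p \<noteq> 0" "\<And>i. coeff p i \<in> M" "poly p a = 0"
    using L(2) unfolding algebraic_over_def by blast
  define Z where "Z = {c \<in> L. poly p c = 0}"
  have "map_poly \<sigma> p = p"
    by (intro poly_eqI) (simp add: coeff_map_poly field_embedding_0[OF \<sigma>(1)] \<sigma>(2) p(2))
  then have "poly p (\<sigma> c) = 0" if "poly p c = 0" for c
    using field_embedding_poly[OF \<sigma>(1), of p c] that by (simp add: field_embedding_0[OF \<sigma>(1)])
  then have "\<sigma> ` Z \<subseteq> Z"
    unfolding Z_def using L(1) by auto
  moreover have "finite Z"
    unfolding Z_def using poly_roots_finite[OF p(1)] by simp
  ultimately have "\<sigma> ` Z = Z"
    by (intro endo_inj_surj inj_on_subset[OF inj_field_embedding[OF \<sigma>(1)]]) simp_all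
  then show "a \<in> \<sigma> ` L"
    using \<open>a \<in> L\<close> p(3) unfolding Z_def by blast
qed

lemma field_automorphism_over_restrict:
  assumes \<sigma>: "field_embedding \<sigma>" "\<And>a. a \<in> M \<Longrightarrow> \<sigma> a = a"
    and L: "\<sigma> ` L \<subseteq> L" "\<And>a. a \<in> L \<Longrightarrow> algebraic_over M a"
  shows "field_automorphism_over M L \<sigma>"
proof -
  have "bij_betw \<sigma> L L"
    using field_embedding_image_eq[OF assms]
      inj_on_subset[OF inj_field_embedding[OF \<sigma>(1)] subset_UNIV] by (simp add: bij_betw_def)
  then show ?thesis
    unfolding field_automorphism_over_def
    using \<sigma> field_embedding_1 field_embedding_add field_embedding_mult by blast
qed

lemma exists_field_embedding_moving:
  fixes M :: "'k::alg_closed_field set"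
  assumes M: "is_subfield M" and "CHAR('k) = 0"
    and algebraic: "\<And>a. algebraic_over M a" and "z \<notin> M"
  obtains \<sigma> where "field_embedding \<sigma>" "\<And>a. a \<in> M \<Longrightarrow> \<sigma> a = a" "\<sigma> z \<noteq> z"
proof -
  interpret M: partial_embedding M "Id_on M"
    by (rule partial_embedding_Id_on[OF M])
  obtain m where m: "minimal_annihilator M m z"
    using minimal_annihilator_exists[OF algebraic] .
  have "degree m \<noteq> 1"
    using annihilates_linear_imp_mem[OF M] \<open>z \<notin> M\<close> m unfolding minimal_annihilator_def by blast
  then have "degree m > 1"
    using minimal_annihilator_degree_pos[OF m] by simp
  then obtain b where b: "b \<noteq> z" "poly m b = 0"
    using simple_root_not_unique_root[OF minimal_annihilator_root[OF m]]
      minimal_annihilator_simple_root[OF assms(2) M m] by blast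
  have "rel_poly (Id_on M) m m"
    using minimal_annihilator_coeff_mem[OF m] by (auto simp: rel_poly_def)
  then obtain H where H: "partial_embedding M H" "(z, b) \<in> H"
    using M.extend_by_root[OF algebraic, of m z m b] m b(2) by auto
  obtain \<sigma> where "field_embedding \<sigma>" "\<And>a b. (a, b) \<in> H \<Longrightarrow> \<sigma> a = b"
    using partial_embedding_total_extension[OF H(1) algebraic] by blast
  then show thesis
    using that[of \<sigma>] H(2) b(1) partial_embedding.fixes_base[OF H(1)] by blast
qed

lemma galois_extension_if_stable:
  fixes L M :: "'k::alg_closed_field set"
  assumes L: "is_subfield L" and M: "is_subfield M" "M \<subseteq> L"
    and char: "CHAR('k) = 0" and algebraic: "\<And>a. algebraic_over M a"
    and stable: "\<And>\<sigma>. field_embedding \<sigma> \<Longrightarrow> (\<And>a. a \<in> M \<Longrightarrow> \<sigma> a = a) \<Longrightarrow> \<sigma> ` L \<subseteq> L"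
  shows "galois_extension L M"
proof -
  have "\<exists>\<sigma>. field_automorphism_over M L \<sigma> \<and> \<sigma> z \<noteq> z" if "z \<notin> M" for z
  proof -
    obtain \<sigma> where \<sigma>: "field_embedding \<sigma>" "\<And>a. a \<in> M \<Longrightarrow> \<sigma> a = a" "\<sigma> z \<noteq> z"
      using exists_field_embedding_moving[OF M(1) char algebraic \<open>z \<notin> M\<close>] by blast
    then have "field_automorphism_over M L \<sigma>"
      by (intro field_automorphism_over_restrict stable algebraic)
    then show ?thesis
      using \<sigma>(3) by blast
  qed
  moreover have "\<sigma> z = z" if "field_automorphism_over M L \<sigma>" "z \<in> M" for \<sigma> z
    using that unfolding field_automorphism_over_def by blast
  ultimately show ?thesis
    unfolding galois_extension_def using L M algebraic by blast
qed

section \<open>Laurent sums\<close>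

lemma algebraic_over_if_laurent_root:
  assumes F: "is_subfield F" and J: "finite J" and a: "\<And>j. j \<in> J \<Longrightarrow> a j \<in> F"
    and k: "k \<in> J" "a k \<noteq> 0" and t: "t \<noteq> 0" "(\<Sum>j\<in>J. a j * t powi j) = 0"
  shows "algebraic_over F t"
proof -
  \<comment> \<open>multiplication by \<open>t ^ N\<close> clears the negative exponents\<close>
  define N where "N = nat (\<Sum>j\<in>J. \<bar>j\<bar>)"
  have exponent_nonneg: "0 \<le> j + int N" if "j \<in> J" for j
    using member_le_sum[OF that, of abs] J by (simp add: N_def sum_nonneg)
  define p where "p = (\<Sum>j\<in>J. monom (a j) (nat (j + int N)))"
  have coeff_p: "coeff p n = (\<Sum>j\<in>J. if nat (j + int N) = n then a j else 0)" for n
    by (simp add: p_def coeff_sum)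
  have "coeff p (nat (k + int N)) = (\<Sum>j\<in>J. if j = k then a j else 0)"
    unfolding coeff_p using exponent_nonneg k(1) by (intro sum.cong) (auto simp: nat_eq_iff)
  also have "\<dots> = a k"
    using J k(1) by simp
  finally have "p \<noteq> 0"
    using k(2) by auto
  moreover have "coeff p n \<in> F" for n
    unfolding coeff_p by (intro is_subfield_sum[OF F]) (auto simp: a is_subfield_0[OF F])
  moreover have "t ^ nat (j + int N) = t powi j * t ^ N" if "j \<in> J" for j
    using exponent_nonneg[OF that] t(1) power_int_add[of t j "int N"] by (simp add: power_int_def)
  then have "poly p t = (\<Sum>j\<in>J. a j * t powi j) * t ^ N"
    by (simp add: p_def poly_sum poly_monom sum_distrib_right mult.assoc)
  ultimately show ?thesis
    unfolding algebraic_over_def using t(2) by auto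
qed

lemma algebraic_over_if_laurent_value_mem:
  assumes F: "is_subfield F" and J: "finite J" and a: "\<And>j. j \<in> J \<Longrightarrow> a j \<in> F"
    and k: "k \<in> J" "a k \<noteq> 0" "k \<noteq> 0" and t: "t \<noteq> 0" "(\<Sum>j\<in>J. a j * t powi j) \<in> F"
  shows "algebraic_over F t"
proof -
  let ?s = "\<Sum>j\<in>J. a j * t powi j"
  define b where "b j = (if j \<in> J then a j else 0) - (if j = 0 then ?s else 0)" for j
  have "b j \<in> F" for j
    unfolding b_def using a t(2)
    by (intro is_subfield_diff[OF F]) (simp_all add: is_subfield_0[OF F])
  moreover have "(\<Sum>j\<in>insert 0 J. b j * t powi j) = 0"
  proof -
    have "(\<Sum>j\<in>insert 0 J. (if j \<in> J then a j else 0) * t powi j) = ?s"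
      using J by (intro sum.mono_neutral_cong_right) auto
    moreover have "(\<Sum>j\<in>insert 0 J. (if j = 0 then ?s else 0) * t powi j) = ?s"
      using J by (subst sum.mono_neutral_right[of _ "{0}"]) auto
    ultimately show ?thesis
      unfolding b_def by (simp add: left_diff_distrib sum_subtractf)
  qed
  ultimately show ?thesis
    using algebraic_over_if_laurent_root[OF F, of "insert 0 J" b k t] J k t(1) by (simp add: b_def)
qed

section \<open>The step polynomial\<close>

definition step_coeff ::
  "('c::field \<Rightarrow> 'k::field) \<Rightarrow> (int \<times> int) set \<Rightarrow> (int \<times> int \<Rightarrow> 'c) \<Rightarrow> 'k \<Rightarrow> int \<Rightarrow> 'k" where
  "step_coeff \<iota> S w u j = (\<Sum>i | (i, j) \<in> S. \<iota> (w (i, j)) * u powi i)"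

lemma finite_horizontal_section: "finite S \<Longrightarrow> finite {i. (i, j) \<in> S}"
  using finite_vimageI[of S "\<lambda>i. (i, j)"] by (simp add: vimage_def inj_on_def)

lemma step_eval_eq_sum_step_coeff:
  assumes "finite S"
  shows "step_eval \<iota> S w u v = (\<Sum>j\<in>snd ` S. step_coeff \<iota> S w u j * v powi j)"
proof -
  have "(\<Sum>j\<in>snd ` S. step_coeff \<iota> S w u j * v powi j) =
      (\<Sum>(j, i)\<in>(SIGMA j:snd ` S. {i. (i, j) \<in> S}). \<iota> (w (i, j)) * u powi i * v powi j)"
    using assms by (simp add: step_coeff_def sum_distrib_right sum.Sigma finite_horizontal_section)
  also have "\<dots> = step_eval \<iota> S w u v"
    unfolding step_eval_def by (rule sum.reindex_bij_witness[of _ prod.swap prod.swap]) force+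
  finally show ?thesis ..
qed

lemma step_eval_swap:
  "step_eval \<iota> (prod.swap ` S) (w \<circ> prod.swap) v u = step_eval \<iota> S w u v"
  unfolding step_eval_def
  by (subst sum.reindex) (auto intro!: sum.cong simp: mult.assoc mult.commute mult.left_commute)

lemma step_coeff_nonzero:
  assumes \<iota>: "field_embedding \<iota>" and u: "\<not> algebraic_over (range \<iota>) u"
    and S: "finite S" "\<And>s. s \<in> S \<Longrightarrow> w s \<noteq> 0" "j \<in> snd ` S"
  shows "step_coeff \<iota> S w u j \<noteq> 0"
proof
  assume "step_coeff \<iota> S w u j = 0"
  moreover obtain i where "(i, j) \<in> S"
    using S(3) by force
  moreover have "u \<noteq> 0"
    using transcendental_nonzero[OF is_subfield_range[OF \<iota>] u] .
  ultimately have "algebraic_over (range \<iota>) u"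
    using S(2) field_embedding_eq_0_iff[OF \<iota>] finite_horizontal_section[OF S(1)]
    unfolding step_coeff_def
    by (intro algebraic_over_if_laurent_root[OF is_subfield_range[OF \<iota>],
          where a = "\<lambda>i. \<iota> (w (i, j))" and k = i]) auto
  then show False
    using u by blast
qed

lemma algebraic_over_second_coordinate:
  assumes \<iota>: "field_embedding \<iota>" and u: "\<not> algebraic_over (range \<iota>) u" and v: "v \<noteq> 0"
    and S: "finite S" "\<And>s. s \<in> S \<Longrightarrow> w s \<noteq> 0" "\<exists>(i, j)\<in>S. j \<noteq> 0"
    and F: "is_subfield F" "range \<iota> \<subseteq> F" "u \<in> F" "step_eval \<iota> S w u v \<in> F"
  shows "algebraic_over F v"
proof -
  obtain k where k: "k \<in> snd ` S" "k \<noteq> 0"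
    using S(3) by force
  have "step_coeff \<iota> S w u j \<in> F" for j
    unfolding step_coeff_def using F(2)
    by (intro is_subfield_sum is_subfield_mult is_subfield_power_int F(1,3)) blast
  then show ?thesis
    using k F(4) S(1) step_coeff_nonzero[OF \<iota> u S(1,2) k(1)]
    unfolding step_eval_eq_sum_step_coeff[OF S(1)]
    by (intro algebraic_over_if_laurent_value_mem[OF F(1) _ _ k(1) _ k(2) v]) simp_all
qed

lemma algebraic_over_first_coordinate:
  assumes \<iota>: "field_embedding \<iota>" and v: "\<not> algebraic_over (range \<iota>) v" and u: "u \<noteq> 0"
    and S: "finite S" "\<And>s. s \<in> S \<Longrightarrow> w s \<noteq> 0" "\<exists>(i, j)\<in>S. i \<noteq> 0"
    and F: "is_subfield F" "range \<iota> \<subseteq> F" "v \<in> F" "step_eval \<iota> S w u v \<in> F"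
  shows "algebraic_over F u"
proof (rule algebraic_over_second_coordinate[OF \<iota> v u])
  show "finite (prod.swap ` S)" "\<exists>(i, j)\<in>prod.swap ` S. j \<noteq> 0"
    using S(1,3) by force+
  show "(w \<circ> prod.swap) s \<noteq> 0" if "s \<in> prod.swap ` S" for s
    using that S(2) by auto
  show "step_eval \<iota> (prod.swap ` S) (w \<circ> prod.swap) v u \<in> F"
    using F(4) by (simp add: step_eval_swap)
qed (fact F)+

lemma algebraically_independent2_transcendental:
  assumes \<iota>: "field_embedding \<iota>" and independent: "algebraically_independent2 \<iota> x y"
  shows "\<not> algebraic_over (range \<iota>) x" "\<not> algebraic_over (range \<iota>) y"
proof -
  have eval_nonzero: "poly (map_poly (\<lambda>q. poly (map_poly \<iota> q) x) P) y \<noteq> 0" if "P \<noteq> 0" for P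
    using independent that unfolding algebraically_independent2_def by blast
  have "poly (map_poly \<iota> q) x \<noteq> 0" if "q \<noteq> 0" for q
    using eval_nonzero[of "[:q:]"] that by (simp add: map_poly_pCons)
  then show "\<not> algebraic_over (range \<iota>) x"
    by (auto simp: algebraic_over_range_iff[OF \<iota>])
  have "poly (map_poly \<iota> q) y \<noteq> 0" if "q \<noteq> 0" for q
  proof -
    let ?P = "map_poly (\<lambda>c. [:c:]) q"
    have "map_poly (\<lambda>q. poly (map_poly \<iota> q) x) ?P = map_poly \<iota> q"
      by (intro poly_eqI) (simp add: coeff_map_poly map_poly_pCons field_embedding_0[OF \<iota>])
    moreover have "?P \<noteq> 0"
      using that by (simp add: map_poly_eq_0_iff)
    ultimately show ?thesis
      using eval_nonzero[of ?P] by simp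
  qed
  then show "\<not> algebraic_over (range \<iota>) y"
    by (auto simp: algebraic_over_range_iff[OF \<iota>])
qed

section \<open>The orbit of a walk\<close>

context
  fixes \<iota> :: "'c::field \<Rightarrow> 'k::field" and \<sigma> :: "'k \<Rightarrow> 'k"
  assumes \<sigma>: "field_embedding \<sigma>" and \<sigma>_\<iota>: "\<And>c. \<sigma> (\<iota> c) = \<iota> c"
begin

lemma field_embedding_step_eval: "\<sigma> (step_eval \<iota> S w u v) = step_eval \<iota> S w (\<sigma> u) (\<sigma> v)"
  unfolding step_eval_def
  by (simp add: field_embedding_sum[OF \<sigma>] field_embedding_mult[OF \<sigma>] \<sigma>_\<iota>
      field_embedding_power_int[OF \<sigma>] case_prod_beta)

lemma step_defined_field_embedding_iff: "step_defined S (\<sigma> u) (\<sigma> v) \<longleftrightarrow> step_defined S u v"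
  unfolding step_defined_def by (simp add: field_embedding_eq_0_iff[OF \<sigma>])

lemma sim_x_map_prod: "sim_x \<iota> S w p q \<Longrightarrow> sim_x \<iota> S w (map_prod \<sigma> \<sigma> p) (map_prod \<sigma> \<sigma> q)"
  and sim_y_map_prod: "sim_y \<iota> S w p q \<Longrightarrow> sim_y \<iota> S w (map_prod \<sigma> \<sigma> p) (map_prod \<sigma> \<sigma> q)"
  unfolding sim_x_def sim_y_def same_step_value_def
  by (auto simp: step_defined_field_embedding_iff simp flip: field_embedding_step_eval)

lemma image_walk_orbit_subset:
  assumes "(\<sigma> x, \<sigma> y) \<in> walk_orbit \<iota> S w x y"
  shows "map_prod \<sigma> \<sigma> ` walk_orbit \<iota> S w x y \<subseteq> walk_orbit \<iota> S w x y"
proof -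
  let ?R = "sup (sim_x \<iota> S w) (sim_y \<iota> S w)"
  have "?R\<^sup>*\<^sup>* (x, y) (map_prod \<sigma> \<sigma> q)" if "?R\<^sup>*\<^sup>* (x, y) q" for q
    using that
  proof (induction rule: rtranclp_induct)
    case base
    show ?case
      using assms by (simp only: walk_orbit_def mem_Collect_eq map_prod_simp)
  next
    case (step q r)
    from step.hyps(2) have "?R (map_prod \<sigma> \<sigma> q) (map_prod \<sigma> \<sigma> r)"
      by (auto intro: sim_x_map_prod sim_y_map_prod)
    with step.IH show ?case
      by (rule rtranclp.rtrancl_into_rtrancl)
  qed
  then show ?thesis
    by (auto simp: walk_orbit_def simp del: sup_apply)
qed

lemma image_orbit_field_subset:
  assumes "(\<sigma> x, \<sigma> y) \<in> walk_orbit \<iota> S w x y"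
    and \<sigma>_base: "\<And>a. a \<in> base_field \<iota> S w x y \<Longrightarrow> \<sigma> a = a"
  shows "\<sigma> ` orbit_field \<iota> S w x y \<subseteq> orbit_field \<iota> S w x y"
proof -
  let ?k = "base_field \<iota> S w x y" and ?O = "walk_orbit \<iota> S w x y"
  have "\<sigma> ` (fst ` ?O) \<subseteq> fst ` ?O" "\<sigma> ` (snd ` ?O) \<subseteq> snd ` ?O"
    using image_walk_orbit_subset[OF assms(1)] by force+
  moreover have "\<sigma> ` ?k \<subseteq> ?k"
    using \<sigma>_base by auto
  ultimately have "\<sigma> ` (?k \<union> (fst ` ?O \<union> snd ` ?O)) \<subseteq> ?k \<union> (fst ` ?O \<union> snd ` ?O)"
    unfolding image_Un by (intro Un_mono)
  also have "\<dots> \<subseteq> orbit_field \<iota> S w x y"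
    unfolding orbit_field_def by (rule subset_field_adjoin)
  finally show ?thesis
    unfolding orbit_field_def
    by (rule image_field_adjoin_subset[OF \<sigma> is_subfield_field_adjoin])
qed

end

locale bivariate_walk =
  fixes \<iota> :: "'c::field_char_0 \<Rightarrow> 'k::alg_closed_field"
    and S :: "(int \<times> int) set" and w :: "int \<times> int \<Rightarrow> 'c" and x y :: 'k
  assumes field_embedding: "field_embedding \<iota>"
    and independent: "algebraically_independent2 \<iota> x y"
    and algebraic_closure: "is_algebraic_closure_of TYPE('k) (field_adjoin (range \<iota>) {x, y})"
    and finite_steps: "finite S"
    and weight_nonzero: "\<And>s. s \<in> S \<Longrightarrow> w s \<noteq> 0"
    and involves_x: "\<exists>(i, j)\<in>S. i \<noteq> 0"
    and involves_y: "\<exists>(i, j)\<in>S. j \<noteq> 0"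
begin

abbreviation "k \<equiv> base_field \<iota> S w x y"
abbreviation "L \<equiv> orbit_field \<iota> S w x y"

lemmas transcendental = algebraically_independent2_transcendental[OF field_embedding independent]

lemma x_nonzero: "x \<noteq> 0" and y_nonzero: "y \<noteq> 0"
  using transcendental transcendental_nonzero[OF is_subfield_range[OF field_embedding]] by auto

lemma range_subset_base_field: "range \<iota> \<subseteq> k"
  and step_eval_mem_base_field: "step_eval \<iota> S w x y \<in> k"
  using subset_field_adjoin[of "range \<iota>" "{step_eval \<iota> S w x y}"] by (simp_all add: base_field_def)

lemma base_field_subset_orbit_field: "k \<subseteq> L"
  and x_mem_orbit_field: "x \<in> L" and y_mem_orbit_field: "y \<in> L"
proof -
  let ?O = "walk_orbit \<iota> S w x y"
  have "(x, y) \<in> ?O"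
    by (simp add: walk_orbit_def)
  then have "x \<in> fst ` ?O" "y \<in> snd ` ?O"
    by force+
  then show "k \<subseteq> L" "x \<in> L" "y \<in> L"
    using subset_field_adjoin[of k "fst ` ?O \<union> snd ` ?O"] by (auto simp: orbit_field_def)
qed

lemma algebraic_over_if_base_field_subset:
  assumes F: "is_subfield F" "k \<subseteq> F" "x \<in> F \<or> y \<in> F"
  shows "algebraic_over F z"
proof (rule algebraic_over_field_adjoin_trans[OF F(1)])
  show "algebraic_over (field_adjoin (range \<iota>) {x, y}) z"
    using algebraic_closure by (simp add: is_algebraic_closure_of_def)
  have k_F: "range \<iota> \<subseteq> F" "step_eval \<iota> S w x y \<in> F"
    using F(2) range_subset_base_field step_eval_mem_base_field by blast+
  have "algebraic_over F y" if "x \<in> F"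
    using algebraic_over_second_coordinate[OF field_embedding transcendental(1) y_nonzero
        finite_steps weight_nonzero involves_y F(1) k_F(1) that k_F(2)] .
  moreover have "algebraic_over F x" if "y \<in> F"
    using algebraic_over_first_coordinate[OF field_embedding transcendental(2) x_nonzero
        finite_steps weight_nonzero involves_x F(1) k_F(1) that k_F(2)] .
  ultimately show "algebraic_over F a" if "a \<in> range \<iota> \<union> {x, y}" for a
    using that F(3) k_F(1) algebraic_over_mem[OF F(1)] by blast
qed

lemma conjugate_mem_walk_orbit:
  assumes \<sigma>: "field_embedding \<sigma>" "\<And>a. a \<in> k \<Longrightarrow> \<sigma> a = a" and "\<sigma> x = x \<or> \<sigma> y = y"
  shows "(\<sigma> x, \<sigma> y) \<in> walk_orbit \<iota> S w x y"
proof -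
  have \<sigma>_\<iota>: "\<sigma> (\<iota> c) = \<iota> c" for c
    using \<sigma>(2) range_subset_base_field by blast
  have "step_eval \<iota> S w (\<sigma> x) (\<sigma> y) = step_eval \<iota> S w x y"
    using field_embedding_step_eval[where \<iota> = \<iota> and S = S and w = w, OF \<sigma>(1) \<sigma>_\<iota>]
      \<sigma>(2)[OF step_eval_mem_base_field] by simp
  then have "same_step_value \<iota> S w (x, y) (\<sigma> x, \<sigma> y)"
    using x_nonzero y_nonzero field_embedding_eq_0_iff[OF \<sigma>(1)]
    by (auto simp: same_step_value_def step_defined_def)
  then have "sup (sim_x \<iota> S w) (sim_y \<iota> S w) (x, y) (\<sigma> x, \<sigma> y)"
    using assms(3) by (auto simp: sim_x_def sim_y_def)
  then show ?thesis
    unfolding walk_orbit_def by (intro CollectI r_into_rtranclp)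
qed

theorem galois_extension_orbit_field:
  assumes A: "A \<subseteq> {x, y}" "A \<noteq> {}"
  shows "galois_extension L (field_adjoin k A)"
proof (rule galois_extension_if_stable)
  let ?M = "field_adjoin k A"
  have M: "k \<subseteq> ?M" "A \<subseteq> ?M"
    using subset_field_adjoin[of k A] by simp_all
  show L: "is_subfield L" and "is_subfield ?M"
    unfolding orbit_field_def by (rule is_subfield_field_adjoin)+
  show "?M \<subseteq> L"
    using A(1) base_field_subset_orbit_field x_mem_orbit_field y_mem_orbit_field
    by (intro field_adjoin_least[OF L]) blast
  show "CHAR('k) = 0"
    by (simp add: CHAR_field_embedding[OF field_embedding])
  show "algebraic_over ?M a" for a
    using A M by (intro algebraic_over_if_base_field_subset is_subfield_field_adjoin) auto
  fix \<sigma> :: "'k \<Rightarrow> 'k"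
  assume \<sigma>: "field_embedding \<sigma>" and \<sigma>_M: "\<And>a. a \<in> ?M \<Longrightarrow> \<sigma> a = a"
  have \<sigma>_k: "\<sigma> a = a" if "a \<in> k" for a
    using \<sigma>_M M(1) that by blast
  have "\<sigma> x = x \<or> \<sigma> y = y"
    using \<sigma>_M A M(2) by blast
  then have "(\<sigma> x, \<sigma> y) \<in> walk_orbit \<iota> S w x y"
    by (intro conjugate_mem_walk_orbit \<sigma> \<sigma>_k)
  then show "\<sigma> ` L \<subseteq> L"
    using range_subset_base_field by (intro image_orbit_field_subset \<sigma> \<sigma>_k) blast
qed

end

theorem mainTheorem1:
  fixes \<iota> :: "complex \<Rightarrow> 'k::alg_closed_field"
    and x y :: 'k
    and S :: "(int \<times> int) set"
    and w :: "int \<times> int \<Rightarrow> complex"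
  assumes "field_embedding \<iota>"
    and "algebraically_independent2 \<iota> x y"
    and "is_algebraic_closure_of TYPE('k) (field_adjoin (range \<iota>) {x, y})"
    and "finite S"
    and "\<And>s. s \<in> S \<Longrightarrow> w s \<noteq> 0"
    and "\<exists>(i, j)\<in>S. i \<noteq> 0"
    and "\<exists>(i, j)\<in>S. j \<noteq> 0"
  shows "galois_extension (orbit_field \<iota> S w x y) (field_adjoin (base_field \<iota> S w x y) {x}) \<and>
         galois_extension (orbit_field \<iota> S w x y) (field_adjoin (base_field \<iota> S w x y) {y}) \<and>
         galois_extension (orbit_field \<iota> S w x y) (field_adjoin (base_field \<iota> S w x y) {x, y})"
proof -
  interpret bivariate_walk \<iota> S w x y
    by (rule bivariate_walk.intro[OF assms])
  show ?thesis
    by (intro conjI galois_extension_orbit_field) simp_all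
qed

end
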